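(* Let $N\ge2$. Write the $2^{2(N-1)}\times2^{2(N-1)}$ transition matrix of the alternating memory-$(N-1)$ game as $$\mathbf M_{N-1}=\begin{pmatrix} M_1\\ M_2\\ M_3\\ M_4\end{pmatrix},$$ where $M_1,\ldots,M_4$ are the $2^{2(N-2)}\times2^{2(N-1)}$ matrices obtained by cutting $\mathbf M_{N-1}$ horizontally into four submatrices of equal dimensions. Then the transition matrix of the alternating memory-$N$ game is $$\mathbf M_N=\begin{pmatrix} M_1'&0&0&0\\ 0&M_2'&0&0\\ 0&0&M_3'&0\\ 0&0&0&M_4'\\ M_1''&0&0&0\\ 0&M_2''&0&0\\ 0&0&M_3''&0\\ 0&0&0&M_4''\\ M_1'''&0&0&0\\ 0&M_2'''&0&0\\ 0&0&M_3'''&0\\ 0&0&0&M_4'''\\ M_1''''&0&0&0\\ 0&M_2''''&0&0\\ 0&0&M_3''''&0\\ 0&0&0&M_4''''\end{pmatrix},$$ where $0$ denotes the $2^{2(N-2)}\times2^{2(N-1)}$ zero matrix and the dashed matrices are obtained from $M_i$ as follows. To the beginning of the index of each $p_{i_1\ldots i_{2(N-1)}}$ occurring in $M_i$ one appends $CC$, $CD$, $DC$ or $DD$ to form, respectively, $M_i'$, $M_i''$, $M_i'''$ or $M_i''''$. In each entry, to the beginning of the index of the variable $q_{j_1\ldots j_{2(N-1)}}$ occurring there one appends the second and third letters (in this order) of the new, length-$2N$ index of the variable $p$ occurring in that entry.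
   Context: For $K\ge1$, the states of the alternating memory-$K$ game are the words $i_1\ldots i_{2K}$ over $\{C,D\}$, ordered lexicographically with $C$ before $D$; the strategies $\mathbf p=(p_{i_1\ldots i_{2K}})$ and $\mathbf q=(q_{j_1\ldots j_{2K}})$ are vectors of $2^{2K}$ variables indexed by such words. Here $p_{i_1\ldots i_{2K}}$ is the leader's probability of cooperating given the last $K$ rounds ($i_{2k-1}i_{2k}$ are the moves of leader and follower in the $k$-th of these rounds, oldest first), and $q_{j_1\ldots j_{2K}}$ is the follower's probability of cooperating given the last $2K$ moves, oldest first, the last being the leader's move in the current round. The transition matrix $\mathbf M_K=\mathbf M_K(\mathbf p,\mathbf q)$ is the $2^{2K}\times2^{2K}$ matrix (regarded as a matrix of polynomials in the entries of $\mathbf p,\mathbf q$), rows and columns indexed by states in lexicographic order, giving the one-round transition probabilities: the row indexed by $i_1\ldots i_{2K}$ has the four entries column $i_3\ldots i_{2K}CC$: $p_{i_1\ldots i_{2K}}\,q_{i_2\ldots i_{2K}C}$; column $i_3\ldots i_{2K}CD$: $p_{i_1\ldots i_{2K}}\,(1-q_{i_2\ldots i_{2K}C})$; column $i_3\ldots i_{2K}DC$: $(1-p_{i_1\ldots i_{2K}})\,q_{i_2\ldots i_{2K}D}$; column $i_3\ldots i_{2K}DD$: $(1-p_{i_1\ldots i_{2K}})\,(1-q_{i_2\ldots i_{2K}D})$, and all other entries are zero (for $K=1$ the word $i_3\ldots i_{2K}$ is empty). Each nonzero entry thus involves exactly one variable from $\mathbf p$ and one from $\mathbf q$. *)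

theory Defs
  imports
    "Jordan_Normal_Form.Matrix"
    "HOL-Library.Poly_Mapping"
    "HOL-Library.List_Lexorder"
begin

section \<open>States of the alternating memory-K game\<close>

datatype move = C | D

instantiation move :: linorder
begin

definition less_move :: "move \<Rightarrow> move \<Rightarrow> bool" where
  "less_move x y \<longleftrightarrow> x = C \<and> y = D"

definition less_eq_move :: "move \<Rightarrow> move \<Rightarrow> bool" where
  "less_eq_move x y \<longleftrightarrow> x = y \<or> x < y"

instance
proof
  fix x y z :: move
  show "x < y \<longleftrightarrow> x \<le> y \<and> \<not> y \<le> x"
    by (cases x; cases y) (auto simp: less_move_def less_eq_move_def)
  show "x \<le> x" by (simp add: less_eq_move_def)
  show "x \<le> y \<Longrightarrow> y \<le> z \<Longrightarrow> x \<le> z"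
    by (auto simp: less_move_def less_eq_move_def)
  show "x \<le> y \<Longrightarrow> y \<le> x \<Longrightarrow> x = y"
    by (auto simp: less_move_def less_eq_move_def)
  show "x \<le> y \<or> y \<le> x"
    by (cases x; cases y) (auto simp: less_move_def less_eq_move_def)
qed

end

text \<open>The linear order on \<^typ>\<open>move list\<close> used here is the lexicographic order of
  \<^theory>\<open>HOL-Library.List_Lexorder\<close>.\<close>

definition states :: "nat \<Rightarrow> move list list" where
  "states K = sorted_list_of_set {w. length w = 2 * K}"

section \<open>Polynomials in the entries of the strategies\<close>

datatype strat_var = P "move list" | Q "move list"

text \<open>A polynomial maps each monomial (an exponent vector with finite support) to its coefficient;
  the multiplication of \<^type>\<open>poly_mapping\<close> is convolution. The variables of the two strategies
  are \<^term>\<open>P w\<close> and \<^term>\<open>Q v\<close>, for words of any length, so that the matrices for all memory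
  lengths have entries in the same ring.\<close>

type_synonym 'a game_poly = "(strat_var \<Rightarrow>\<^sub>0 nat) \<Rightarrow>\<^sub>0 'a"

definition Var :: "strat_var \<Rightarrow> 'a::comm_ring_1 game_poly" where
  "Var x = Poly_Mapping.single (Poly_Mapping.single x 1) 1"

definition vars :: "'a::comm_ring_1 game_poly \<Rightarrow> strat_var set" where
  "vars f = (\<Union>m \<in> Poly_Mapping.keys f. Poly_Mapping.keys m)"

definition rename_vars ::
  "(strat_var \<Rightarrow> strat_var) \<Rightarrow> 'a::comm_ring_1 game_poly \<Rightarrow> 'a game_poly" where
  "rename_vars g f =
     (\<Sum>m \<in> Poly_Mapping.keys f.
        Poly_Mapping.single
          (\<Sum>x \<in> Poly_Mapping.keys m. Poly_Mapping.single (g x) (Poly_Mapping.lookup m x))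
          (Poly_Mapping.lookup f m))"

section \<open>The transition matrix\<close>

text \<open>For \<open>w = i\<^sub>1\<dots>i\<^sub>2\<^sub>K\<close>, the word \<^term>\<open>drop 2 w\<close> is \<open>i\<^sub>3\<dots>i\<^sub>2\<^sub>K\<close> and \<^term>\<open>tl w\<close> is
  \<open>i\<^sub>2\<dots>i\<^sub>2\<^sub>K\<close>.\<close>

definition transition_prob :: "move list \<Rightarrow> move list \<Rightarrow> 'a::comm_ring_1 game_poly" where
  "transition_prob w v =
     (if v = drop 2 w @ [C, C] then Var (P w) * Var (Q (tl w @ [C]))
      else if v = drop 2 w @ [C, D] then Var (P w) * (1 - Var (Q (tl w @ [C])))
      else if v = drop 2 w @ [D, C] then (1 - Var (P w)) * Var (Q (tl w @ [D]))
      else if v = drop 2 w @ [D, D] then (1 - Var (P w)) * (1 - Var (Q (tl w @ [D])))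
      else 0)"

definition transition_mat :: "nat \<Rightarrow> 'a::comm_ring_1 game_poly mat" where
  "transition_mat K =
     mat (2 ^ (2 * K)) (2 ^ (2 * K)) (\<lambda>(r, c). transition_prob (states K ! r) (states K ! c))"

section \<open>Prepending letters to the indices of the variables\<close>

text \<open>Only used for entries in which exactly one variable \<^term>\<open>P w\<close> occurs, and for the
  zero entries. In the latter case the description is arbitrary, but harmless: \<^const>\<open>rename_vars\<close>
  maps 0 to 0.\<close>

definition leader_index :: "'a::comm_ring_1 game_poly \<Rightarrow> move list" where
  "leader_index f = (THE w. P w \<in> vars f)"

text \<open>With \<open>w = u @ leader_index f\<close> the new index of the variable of the leader, positions 1 and 2 of
  \<open>w\<close> (counted from 0) are its second and third letters.\<close>

definition prepend_entry :: "move list \<Rightarrow> 'a::comm_ring_1 game_poly \<Rightarrow> 'a game_poly" where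
  "prepend_entry u f =
     (let w = u @ leader_index f
      in rename_vars (\<lambda>x. case x of P i \<Rightarrow> P (u @ i) | Q j \<Rightarrow> Q ([w ! 1, w ! 2] @ j)) f)"

definition prepend_mat :: "move list \<Rightarrow> 'a::comm_ring_1 game_poly mat \<Rightarrow> 'a game_poly mat" where
  "prepend_mat u A = map_mat (prepend_entry u) A"

section \<open>Block matrices\<close>

text \<open>The horizontal counterpart of \<^const>\<open>append_rows\<close>; it binds more tightly.\<close>

definition append_cols :: "'a::zero mat \<Rightarrow> 'a mat \<Rightarrow> 'a mat" (infixr \<open>@\<^sub>c\<close> 67) where
  "A @\<^sub>c B = four_block_mat A B (0\<^sub>m 0 (dim_col A)) (0\<^sub>m 0 (dim_col B))"

end

theory Submission
  imports Defs
begin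

text \<open>A state of the memory-\<open>N\<close> game is \<open>u @ t @ x\<close> with two rounds \<open>u\<close>, \<open>t\<close> of two letters each.
  Its successors are the states \<open>t @ v\<close>, where \<open>v\<close> runs through the successors of the shorter state
  \<open>t @ x\<close>, and the probabilities are the same up to the names of the variables. In the lexicographic
  order \<open>u\<close> and \<open>t\<close> number the block rows and the first round of the column numbers the block columns,
  so a block vanishes unless its column number is that of \<open>t\<close>.\<close>

section \<open>Block indices\<close>

text \<open>Lists let a block be addressed by its number. The separate singleton clause makes a
  stack unfold literally to the nested \<open>@\<^sub>r\<close> of the theorem, with no empty block
  at the end.\<close>

fun stack_rows :: "'a::zero mat list \<Rightarrow> 'a mat" where
  "stack_rows [] = 0\<^sub>m 0 0"
| "stack_rows [A] = A"
| "stack_rows (A # B # As) = A @\<^sub>r stack_rows (B # As)"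

fun stack_cols :: "'a::zero mat list \<Rightarrow> 'a mat" where
  "stack_cols [] = 0\<^sub>m 0 0"
| "stack_cols [A] = A"
| "stack_cols (A # B # As) = A @\<^sub>c stack_cols (B # As)"

lemma append_cols_carrier:
  assumes "A \<in> carrier_mat n m" "B \<in> carrier_mat n k"
  shows "A @\<^sub>c B \<in> carrier_mat n (m + k)"
  using assms by (auto simp: append_cols_def)

lemma stack_rows_carrier:
  assumes "As \<noteq> []" "set As \<subseteq> carrier_mat n m"
  shows "stack_rows As \<in> carrier_mat (length As * n) m"
  using assms
proof (induction As rule: stack_rows.induct)
  case (3 A B As)
  then have "A \<in> carrier_mat n m" "stack_rows (B # As) \<in> carrier_mat (length (B # As) * n) m"
    by auto
  from carrier_append_rows[OF this] show ?case
    by simp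
qed auto

lemma stack_cols_carrier:
  assumes "As \<noteq> []" "set As \<subseteq> carrier_mat n m"
  shows "stack_cols As \<in> carrier_mat n (length As * m)"
  using assms
proof (induction As rule: stack_cols.induct)
  case (3 A B As)
  then have "A \<in> carrier_mat n m" "stack_cols (B # As) \<in> carrier_mat n (length (B # As) * m)"
    by auto
  from append_cols_carrier[OF this] show ?case
    by simp
qed auto

lemma block_index_less:
  fixes n q s k :: nat
  assumes "q < k" "s < n"
  shows "q * n + s < k * n"
proof -
  have "q * n + s < Suc q * n"
    using assms by simp
  also have "\<dots> \<le> k * n"
    using assms by (intro mult_le_mono1) simp
  finally show ?thesis .
qed

lemma index_stack_rows:
  assumes "q < length As" "set As \<subseteq> carrier_mat n m" "s < n" "j < m"
  shows "stack_rows As $$ (q * n + s, j) = As ! q $$ (s, j)"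
  using assms
proof (induction As arbitrary: q rule: stack_rows.induct)
  case (3 A B As)
  have A: "dim_row A = n" "dim_col A = m"
    using 3 by auto
  have "stack_rows (B # As) \<in> carrier_mat (length (B # As) * n) m"
    using 3 by (intro stack_rows_carrier) auto
  then have B: "dim_row (stack_rows (B # As)) = length (B # As) * n"
    "dim_col (stack_rows (B # As)) = m"
    by auto
  have less: "q * n + s < n + length (B # As) * n"
    using block_index_less[OF 3(2) 3(4)] by simp
  show ?case
  proof (cases q)
    case 0
    then show ?thesis
      using 3 less by (simp add: append_rows_def A B)
  next
    case (Suc p)
    have "stack_rows (B # As) $$ (p * n + s, j) = (B # As) ! p $$ (s, j)"
      using 3 Suc by (intro 3) auto
    then show ?thesis
      using less \<open>j < m\<close> by (simp add: append_rows_def A B Suc)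
  qed
qed auto

lemma index_stack_cols:
  assumes "q < length As" "set As \<subseteq> carrier_mat n m" "i < n" "s < m"
  shows "stack_cols As $$ (i, q * m + s) = As ! q $$ (i, s)"
  using assms
proof (induction As arbitrary: q rule: stack_cols.induct)
  case (3 A B As)
  have A: "dim_row A = n" "dim_col A = m"
    using 3 by auto
  have "stack_cols (B # As) \<in> carrier_mat n (length (B # As) * m)"
    using 3 by (intro stack_cols_carrier) auto
  then have B: "dim_row (stack_cols (B # As)) = n"
    "dim_col (stack_cols (B # As)) = length (B # As) * m"
    by auto
  have less: "q * m + s < m + length (B # As) * m"
    using block_index_less[OF 3(2) 3(5)] by simp
  show ?case
  proof (cases q)
    case 0
    then show ?thesis
      using 3 less by (simp add: append_cols_def A B)
  next
    case (Suc p)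
    have "stack_cols (B # As) $$ (i, p * m + s) = (B # As) ! p $$ (i, s)"
      using 3 Suc by (intro 3) auto
    then show ?thesis
      using less \<open>i < n\<close> by (simp add: append_cols_def A B Suc)
  qed
qed auto

section \<open>The lexicographic list of states\<close>

text \<open>The lexicographic order of this list makes the position of a round the number of its
  block.\<close>

definition rounds :: "move list list" where
  "rounds = [[C, C], [C, D], [D, C], [D, D]]"

lemma distinct_rounds: "distinct rounds"
  by (simp add: rounds_def)

lemma length_rounds: "length rounds = 4"
  by (simp add: rounds_def)

lemma length_nth_rounds: "a < 4 \<Longrightarrow> length (rounds ! a) = 2"
  by (auto simp: rounds_def less_Suc_eq numeral_eq_Suc)

lemma set_rounds: "set rounds = {w. length w = 2}"
proof -
  have "[x, y] \<in> set rounds" for x y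
    by (cases x; cases y) (auto simp: rounds_def)
  then show ?thesis
    by (auto simp: rounds_def length_Suc_conv numeral_eq_Suc)
qed

lemma UNIV_move: "UNIV = {C, D}"
  using move.exhaust by auto

instance move :: finite
  by standard (simp add: UNIV_move)

text \<open>On an infinite set \<open>sorted_list_of_set\<close> is the empty list, so the meaning
  of \<open>states\<close> rests on this.\<close>

lemma finite_words: "finite {w :: move list. length w = n}"
  using finite_lists_length_eq[of "UNIV :: move set" n] by simp

lemma set_states: "set (states K) = {w. length w = 2 * K}"
  by (simp add: states_def finite_words)

lemma card_words: "card {w :: move list. length w = n} = 2 ^ n"
proof -
  have "card (UNIV :: move set) = 2"
    by (simp add: UNIV_move)
  then show ?thesis
    using card_lists_length_eq[of "UNIV :: move set" n] by simp
qed

lemma length_states: "length (states K) = 2 ^ (2 * K)"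
  by (simp add: states_def card_words)

lemma length_nth_states: "r < 2 ^ (2 * K) \<Longrightarrow> length (states K ! r) = 2 * K"
  using nth_mem[of r "states K"] by (simp add: set_states length_states)

lemma sorted_map_append_left:
  "sorted xs \<Longrightarrow> sorted (map ((@) u) xs)" for xs :: "'a::linorder list list"
proof -
  have "u @ x \<le> u @ y" if "x \<le> y" for x y
    using that by (induction u) auto
  then show "sorted xs \<Longrightarrow> sorted (map ((@) u) xs)"
    by (induction xs) auto
qed

text \<open>A sorted list without repetitions is determined by its set. The first round decides a
  lexicographic comparison before the rest does, so grouping by first round keeps the list
  sorted.\<close>

lemma states_Suc: "states (Suc K) = concat (map (\<lambda>u. map ((@) u) (states K)) rounds)"
proof -
  let ?L = "concat (map (\<lambda>u. map ((@) u) (states K)) rounds)"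
  have app: "u @ x \<in> set ?L" if "u \<in> set rounds" "x \<in> set (states K)" for u x
    using that by auto
  have "w \<in> set ?L" if "length w = 2 * Suc K" for w
    using app[of "take 2 w" "drop 2 w"] that unfolding set_rounds set_states by simp
  then have set: "set ?L = {w. length w = 2 * Suc K}"
    by (auto simp: set_rounds set_states)
  have "sorted (states K)"
    by (simp add: states_def)
  then have "sorted ?L"
    by (auto simp: rounds_def sorted_append sorted_map_append_left less_move_def)
  moreover have "distinct ?L"
    by (auto simp: rounds_def distinct_map inj_on_def states_def)
  ultimately show ?thesis
    using set unfolding states_def by (intro sorted_distinct_set_unique) (auto simp: finite_words)
qed

text \<open>The leading digit of a position in base \<open>2 ^ (2 * K)\<close> is the number of the
  first round. Used at two successive memory lengths, this reads off the first two rounds of a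
  state.\<close>

lemma nth_states_Suc:
  assumes "a < 4" "r < 2 ^ (2 * K)"
  shows "states (Suc K) ! (a * 2 ^ (2 * K) + r) = rounds ! a @ states K ! r"
proof -
  from \<open>a < 4\<close> consider "a = 0" | "a = 1" | "a = 2" | "a = 3"
    by linarith
  then show ?thesis
    by cases (use assms in \<open>simp_all add: states_Suc rounds_def nth_append length_states\<close>)
qed

section \<open>Renaming the variables of an entry\<close>

text \<open>Cancellation can shrink the support of a difference, so sums over different supports are
  compared over a common superset. The added monomials have coefficient 0.\<close>

lemma rename_vars_superset:
  assumes "finite A" "Poly_Mapping.keys f \<subseteq> A"
  shows "rename_vars g f =
     (\<Sum>m \<in> A. Poly_Mapping.single
        (\<Sum>x \<in> Poly_Mapping.keys m. Poly_Mapping.single (g x) (Poly_Mapping.lookup m x))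
        (Poly_Mapping.lookup f m))"
  unfolding rename_vars_def using assms
  by (intro sum.mono_neutral_left) (auto simp: in_keys_iff)

lemma rename_vars_0: "rename_vars g 0 = 0"
  by (simp add: rename_vars_def)

lemma rename_vars_diff: "rename_vars g (f - h) = rename_vars g f - rename_vars g h"
proof -
  let ?A = "Poly_Mapping.keys f \<union> Poly_Mapping.keys h"
  have "Poly_Mapping.keys (f - h) \<subseteq> ?A"
    by (auto simp: in_keys_iff lookup_minus)
  then show ?thesis
    by (simp add: rename_vars_superset[of ?A] lookup_minus single_diff sum_subtractf)
qed

lemma rename_vars_add: "rename_vars g (f + h) = rename_vars g f + rename_vars g h"
  using rename_vars_diff[of g "f + h" h] by simp

lemma rename_vars_1: "rename_vars g 1 = 1"
  by (simp add: rename_vars_def flip: single_one)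

lemma rename_vars_Var: "rename_vars g (Var x) = Var (g x)"
  by (simp add: rename_vars_def Var_def)

lemma Var_mult_Var:
  "Var x * Var y = Poly_Mapping.single (Poly_Mapping.single x 1 + Poly_Mapping.single y 1) 1"
  by (simp add: Var_def mult_single)

lemma keys_add_single:
  fixes x y :: 'v
  shows "Poly_Mapping.keys (Poly_Mapping.single x (Suc 0) + Poly_Mapping.single y (Suc 0)) = {x, y}"
  by (auto simp: in_keys_iff lookup_add lookup_single when_def split: if_splits)

text \<open>The product of the two variables is the only monomial of degree two in an entry, so
  together with additivity this case replaces full multiplicativity. As \<open>x \<noteq> y\<close>,
  both exponents are 1.\<close>

lemma rename_vars_Var_mult_Var:
  assumes "x \<noteq> y"
  shows "rename_vars g (Var x * Var y) = Var (g x) * Var (g y)"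
proof -
  have "(\<Sum>z \<in> {x, y}. Poly_Mapping.single (g z)
        (Poly_Mapping.lookup (Poly_Mapping.single x 1 + Poly_Mapping.single y (1::nat)) z))
      = Poly_Mapping.single (g x) 1 + Poly_Mapping.single (g y) 1"
    using assms by (simp add: lookup_add lookup_single)
  then show ?thesis
    unfolding Var_mult_Var by (simp add: rename_vars_def keys_add_single)
qed

text \<open>For each outcome \<open>(x, y)\<close> of a round the coefficient of the monomial \<open>p q\<close> is \<open>\<plusminus>1\<close>, so the
  variables occurring in the entry are visible in this single monomial.\<close>

definition outcome_prob :: "move \<Rightarrow> move \<Rightarrow> strat_var \<Rightarrow> strat_var \<Rightarrow> 'a::comm_ring_1 game_poly" where
  "outcome_prob x y p q =
     (if x = C then Var p else 1 - Var p) * (if y = C then Var q else 1 - Var q)"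

lemma rename_vars_outcome_prob:
  assumes "p \<noteq> q"
  shows "rename_vars g (outcome_prob x y p q) = outcome_prob x y (g p) (g q)"
  using assms by (simp add: outcome_prob_def algebra_simps rename_vars_diff rename_vars_1
      rename_vars_Var rename_vars_Var_mult_Var rename_vars_add)

lemma vars_outcome_prob:
  assumes "p \<noteq> q"
  shows "vars (outcome_prob x y p q :: 'a::comm_ring_1 game_poly) = {p, q}"
proof -
  let ?f = "outcome_prob x y p q :: 'a game_poly"
  let ?p = "Poly_Mapping.single p (1::nat)"
  let ?q = "Poly_Mapping.single q (1::nat)"
  \<comment> \<open>The monomial \<open>?p + ?q\<close> has two keys and the other three have at
    most one, so nothing cancels its coefficient.\<close>
  have "?p + ?q \<noteq> 0" "?p + ?q \<noteq> ?p" "?p + ?q \<noteq> ?q"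
    using assms keys_add_single[of p q] by auto
  then have mem: "?p + ?q \<in> Poly_Mapping.keys ?f"
    by (auto simp: outcome_prob_def Var_mult_Var Var_def algebra_simps in_keys_iff lookup_minus
        lookup_add lookup_single mult_single lookup_one when_def)
  have sub: "Poly_Mapping.keys ?f \<subseteq> {0, ?p, ?q, ?p + ?q}"
    by (auto simp: outcome_prob_def Var_def algebra_simps in_keys_iff lookup_minus
        lookup_add lookup_single mult_single lookup_one when_def split: if_splits)
  have "Poly_Mapping.keys m \<subseteq> {p, q}" if m: "m \<in> Poly_Mapping.keys ?f" for m
  proof -
    consider "m = 0" | "m = ?p" | "m = ?q" | "m = ?p + ?q"
      using m sub by blast
    then show ?thesis
      by cases (simp_all add: keys_add_single)
  qed
  then show ?thesis
    using mem keys_add_single[of p q] unfolding vars_def One_nat_def by blast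
qed

section \<open>Transition probabilities when a round is prepended\<close>

lemma transition_prob_outcome:
  "transition_prob w (drop 2 w @ [x, y]) = outcome_prob x y (P w) (Q (tl w @ [x]))"
  by (cases x; cases y) (simp_all add: transition_prob_def outcome_prob_def)

lemma transition_prob_eq_0:
  assumes "\<And>x y. v \<noteq> drop 2 w @ [x, y]"
  shows "transition_prob w v = 0"
  using assms by (simp add: transition_prob_def)

lemma leader_index_outcome_prob: "leader_index (outcome_prob x y (P w) (Q v)) = w"
  by (simp add: leader_index_def vars_outcome_prob)

text \<open>Dropping the first round of \<open>u @ w\<close> leaves \<open>w\<close>, so its
  successors are those of \<open>w\<close> prefixed with \<open>take 2 w\<close>. The follower's
  index grows from \<open>tl w @ [x]\<close> to \<open>tl u @ w @ [x]\<close>: the added letters are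
  the last of \<open>u\<close> and the first of \<open>w\<close>, which are the second and third
  letters of \<open>u @ w\<close>.\<close>

lemma prepend_entry_transition_prob:
  assumes "length u = 2" "length w \<ge> 2"
  shows "prepend_entry u (transition_prob w v) = transition_prob (u @ w) (take 2 w @ v)"
proof (cases "\<exists>x y. v = drop 2 w @ [x, y]")
  case True
  then obtain x y where v: "v = drop 2 w @ [x, y]"
    by blast
  have w: "take 2 w @ drop 2 w @ z = drop 2 (u @ w) @ z" for z
    using assms by simp
  obtain a b where u: "u = [a, b]"
    using assms by (auto simp: length_Suc_conv numeral_eq_Suc)
  obtain c z where "w = c # z"
    using assms by (cases w) auto
  then show ?thesis
    unfolding v w transition_prob_outcome
    by (simp add: prepend_entry_def leader_index_outcome_prob rename_vars_outcome_prob u)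
next
  case False
  \<comment> \<open>Prefixing \<open>take 2 w\<close> is injective, so a non-successor stays one and
    both sides are 0.\<close>
  moreover have "take 2 w @ v \<noteq> drop 2 (u @ w) @ [x, y]" for x y
  proof
    assume "take 2 w @ v = drop 2 (u @ w) @ [x, y]"
    also have "\<dots> = take 2 w @ drop 2 w @ [x, y]"
      using assms by simp
    finally show False
      using False by simp
  qed
  ultimately show ?thesis
    by (simp add: transition_prob_eq_0 prepend_entry_def rename_vars_0 Let_def)
qed

text \<open>Every successor of \<open>u @ s @ w\<close> starts with the round \<open>s\<close>. This
  accounts for the zero blocks.\<close>

lemma transition_prob_mismatch:
  assumes "length u = 2" "length s = 2" "length t = 2" "t \<noteq> s"
  shows "transition_prob (u @ s @ w) (t @ v) = 0"
  using assms by (intro transition_prob_eq_0) auto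

section \<open>The block form of the transition matrix\<close>

lemma transition_mat_carrier: "transition_mat K \<in> carrier_mat (2 ^ (2 * K)) (2 ^ (2 * K))"
  by (simp add: transition_mat_def)

text \<open>The theorem in indexed form, with \<open>N = K + 2\<close>. The list update puts the
  renamed block in column \<open>b\<close> of a row of zero blocks.\<close>

lemma transition_mat_Suc_Suc:
  fixes K :: nat and Ms :: "'a::comm_ring_1 game_poly mat list"
  defines "n \<equiv> 2 ^ (2 * K)" and "m \<equiv> 2 ^ (2 * Suc K)"
  defines "Z \<equiv> 0\<^sub>m n m"
  assumes Ms: "set Ms \<subseteq> carrier_mat n m" "length Ms = 4"
    and cut: "transition_mat (Suc K) = stack_rows Ms"
  shows "transition_mat (Suc (Suc K)) =
    stack_rows (concat (map (\<lambda>u. map (\<lambda>b. stack_cols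
      ((replicate 4 Z)[b := prepend_mat u (Ms ! b)])) [0..<4]) rounds))"
    (is "_ = stack_rows ?L")
proof (rule eq_matI)
  let ?row = "\<lambda>u b. (replicate 4 Z)[b := prepend_mat u (Ms ! b)]"
  \<comment> \<open>A block column is as wide as the whole shorter matrix, that is, four block
    heights.\<close>
  have m: "m = 4 * n"
    by (simp add: m_def n_def)
  have size: "2 ^ (2 * Suc (Suc K)) = 4 * m"
    by (simp add: m_def)
  have Mb: "Ms ! b \<in> carrier_mat n m" if "b < 4" for b
    using Ms that by auto
  have row: "set (?row u b) \<subseteq> carrier_mat n m" if "b < 4" for u b
    using Mb[OF that] set_update_subset_insert[of "replicate 4 Z" b "prepend_mat u (Ms ! b)"]
    by (auto simp: Z_def prepend_mat_def)
  have "stack_cols (?row u b) \<in> carrier_mat n (4 * m)" if "b < 4" for u b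
    using stack_cols_carrier[OF _ row[OF that]] by (simp flip: length_0_conv)
  then have L: "set ?L \<subseteq> carrier_mat n (4 * m)"
    by auto
  have len: "length ?L = 16"
    by (simp add: rounds_def)
  have nth_L: "?L ! (4 * a + b) = stack_cols (?row (rounds ! a) b)" if "a < 4" "b < 4" for a b
  proof -
    have "a = 0 \<or> a = 1 \<or> a = 2 \<or> a = 3" "b = 0 \<or> b = 1 \<or> b = 2 \<or> b = 3"
      using that by linarith+
    then show ?thesis
      by (elim disjE) (simp_all add: rounds_def upt_rec numeral_nat del: list_update.simps)
  qed
  have "?L \<noteq> []"
    using len by auto
  from stack_rows_carrier[OF this L]
  have stack: "stack_rows ?L \<in> carrier_mat (4 * m) (4 * m)"
    unfolding len by (simp add: m)
  have trans: "transition_mat (Suc (Suc K)) \<in> carrier_mat (4 * m) (4 * m)"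
    using transition_mat_carrier[of "Suc (Suc K)"] unfolding size .
  show "dim_row (transition_mat (Suc (Suc K))) = dim_row (stack_rows ?L)"
    "dim_col (transition_mat (Suc (Suc K))) = dim_col (stack_rows ?L)"
    using stack trans by auto
  fix r c
  assume "r < dim_row (stack_rows ?L)" "c < dim_col (stack_rows ?L)"
  then have rc: "r < 4 * m" "c < 4 * m"
    using stack by auto
  \<comment> \<open>The row number splits into the numbers \<open>a\<close>, \<open>b\<close> of the
    first two rounds and a rest \<open>s\<close>, the column number into the first round
    \<open>t\<close> and a rest \<open>j\<close>.\<close>
  define a where "a = r div m"
  define b where "b = r mod m div n"
  define s where "s = r mod m mod n"
  define t where "t = c div m"
  define j where "j = c mod m"
  have n0: "n > 0"
    by (simp add: n_def)
  have m0: "m > 0"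
    by (simp add: m_def)
  have bounds: "a < 4" "b < 4" "s < n" "t < 4" "j < m"
    using rc n0 m0 unfolding a_def b_def s_def t_def j_def
    by (simp_all add: less_mult_imp_div_less m)
  have bs: "b * n + s < m"
    using block_index_less[OF bounds(2,3)] by (simp add: m)
  have r: "r = a * m + (b * n + s)"
    by (simp add: a_def b_def s_def)
  \<comment> \<open>Two readings of one row: \<open>r\<close> splits off the first round and finds
    the state, \<open>r'\<close> shows the block row \<open>4 * a + b\<close> and indexes the
    stack.\<close>
  have r': "r = (4 * a + b) * n + s"
    by (simp add: r m algebra_simps)
  have c: "c = t * m + j"
    by (simp add: t_def j_def)
  define w where "w = states (Suc K) ! (b * n + s)"
  define v where "v = states (Suc K) ! j"
  have w: "w = rounds ! b @ states K ! s"
    using bounds nth_states_Suc[of b s K] by (simp add: w_def n_def)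
  have take_w: "take 2 w = rounds ! b" and len_w: "length w \<ge> 2"
    using bounds by (simp_all add: w length_nth_rounds)
  have "transition_mat (Suc (Suc K)) $$ (r, c)
      = (transition_prob (rounds ! a @ w) (rounds ! t @ v) :: 'a game_poly)"
    using rc bounds bs nth_states_Suc[of a "b * n + s" "Suc K"] nth_states_Suc[of t j "Suc K"]
    by (simp add: transition_mat_def size w_def v_def r c m_def del: power_Suc mult_Suc_right)
  also have "\<dots> = ?row (rounds ! a) b ! t $$ (s, j)"
  proof (cases "t = b")
    case True
    \<comment> \<open>Row \<open>s\<close> of block \<open>b\<close> is row \<open>b * n + s\<close>
      of the shorter matrix, whose state is \<open>w\<close>.\<close>
    have "Ms ! b $$ (s, j) = stack_rows Ms $$ (b * n + s, j)"
      using bounds Ms by (intro index_stack_rows[symmetric]) auto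
    also have "\<dots> = transition_prob w v"
      using bs bounds unfolding cut[symmetric] transition_mat_def w_def v_def
      by (simp add: m_def del: power_Suc mult_Suc_right)
    finally have "prepend_mat (rounds ! a) (Ms ! b) $$ (s, j)
        = prepend_entry (rounds ! a) (transition_prob w v)"
      using Mb[OF bounds(2)] bounds by (simp add: prepend_mat_def)
    also have "\<dots> = transition_prob (rounds ! a @ w) (rounds ! b @ v)"
      using bounds len_w by (simp add: prepend_entry_transition_prob length_nth_rounds take_w)
    finally show ?thesis
      using True bounds by simp
  next
    case False
    then have "rounds ! t \<noteq> rounds ! b"
      using bounds by (simp add: nth_eq_iff_index_eq distinct_rounds length_rounds)
    then show ?thesis
      using False bounds by (simp add: w transition_prob_mismatch length_nth_rounds Z_def)
  qed
  also have "\<dots> = stack_cols (?row (rounds ! a) b) $$ (s, c)"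
    using bounds row[OF bounds(2)] unfolding c by (intro index_stack_cols[symmetric]) auto
  also have "\<dots> = ?L ! (4 * a + b) $$ (s, c)"
    using nth_L bounds by simp
  also have "\<dots> = stack_rows ?L $$ (r, c)"
    unfolding r' using bounds rc L len by (intro index_stack_rows[symmetric]) auto
  finally show "transition_mat (Suc (Suc K)) $$ (r, c) = stack_rows ?L $$ (r, c)" .
qed

theorem lemma2p5:
  fixes N :: nat
    and M\<^sub>1 M\<^sub>2 M\<^sub>3 M\<^sub>4 Z :: "'a::comm_ring_1 game_poly mat"
  assumes "N \<ge> 2"
    and "M\<^sub>1 \<in> carrier_mat (2 ^ (2 * (N - 2))) (2 ^ (2 * (N - 1)))"
    and "M\<^sub>2 \<in> carrier_mat (2 ^ (2 * (N - 2))) (2 ^ (2 * (N - 1)))"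
    and "M\<^sub>3 \<in> carrier_mat (2 ^ (2 * (N - 2))) (2 ^ (2 * (N - 1)))"
    and "M\<^sub>4 \<in> carrier_mat (2 ^ (2 * (N - 2))) (2 ^ (2 * (N - 1)))"
    and "transition_mat (N - 1) = M\<^sub>1 @\<^sub>r M\<^sub>2 @\<^sub>r M\<^sub>3 @\<^sub>r M\<^sub>4"
  defines "Z \<equiv> 0\<^sub>m (2 ^ (2 * (N - 2))) (2 ^ (2 * (N - 1)))"
  shows "transition_mat N =
       prepend_mat [C, C] M\<^sub>1 @\<^sub>c Z @\<^sub>c Z @\<^sub>c Z
    @\<^sub>r Z @\<^sub>c prepend_mat [C, C] M\<^sub>2 @\<^sub>c Z @\<^sub>c Z
    @\<^sub>r Z @\<^sub>c Z @\<^sub>c prepend_mat [C, C] M\<^sub>3 @\<^sub>c Z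
    @\<^sub>r Z @\<^sub>c Z @\<^sub>c Z @\<^sub>c prepend_mat [C, C] M\<^sub>4
    @\<^sub>r prepend_mat [C, D] M\<^sub>1 @\<^sub>c Z @\<^sub>c Z @\<^sub>c Z
    @\<^sub>r Z @\<^sub>c prepend_mat [C, D] M\<^sub>2 @\<^sub>c Z @\<^sub>c Z
    @\<^sub>r Z @\<^sub>c Z @\<^sub>c prepend_mat [C, D] M\<^sub>3 @\<^sub>c Z
    @\<^sub>r Z @\<^sub>c Z @\<^sub>c Z @\<^sub>c prepend_mat [C, D] M\<^sub>4
    @\<^sub>r prepend_mat [D, C] M\<^sub>1 @\<^sub>c Z @\<^sub>c Z @\<^sub>c Z
    @\<^sub>r Z @\<^sub>c prepend_mat [D, C] M\<^sub>2 @\<^sub>c Z @\<^sub>c Z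
    @\<^sub>r Z @\<^sub>c Z @\<^sub>c prepend_mat [D, C] M\<^sub>3 @\<^sub>c Z
    @\<^sub>r Z @\<^sub>c Z @\<^sub>c Z @\<^sub>c prepend_mat [D, C] M\<^sub>4
    @\<^sub>r prepend_mat [D, D] M\<^sub>1 @\<^sub>c Z @\<^sub>c Z @\<^sub>c Z
    @\<^sub>r Z @\<^sub>c prepend_mat [D, D] M\<^sub>2 @\<^sub>c Z @\<^sub>c Z
    @\<^sub>r Z @\<^sub>c Z @\<^sub>c prepend_mat [D, D] M\<^sub>3 @\<^sub>c Z
    @\<^sub>r Z @\<^sub>c Z @\<^sub>c Z @\<^sub>c prepend_mat [D, D] M\<^sub>4"
proof -
  define K where "K = N - 2"
  have N: "N = Suc (Suc K)" "N - 1 = Suc K" "N - 2 = K"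
    using \<open>N \<ge> 2\<close> by (simp_all add: K_def)
  have "set [M\<^sub>1, M\<^sub>2, M\<^sub>3, M\<^sub>4] \<subseteq> carrier_mat (2 ^ (2 * K)) (2 ^ (2 * Suc K))"
    using assms(2-5) unfolding N by simp
  moreover have "transition_mat (Suc K) = stack_rows [M\<^sub>1, M\<^sub>2, M\<^sub>3, M\<^sub>4]"
    using assms(6) unfolding N by simp
  moreover have Z: "Z = 0\<^sub>m (2 ^ (2 * K)) (2 ^ (2 * Suc K))"
    unfolding Z_def N by simp
  ultimately have "transition_mat N =
    stack_rows (concat (map (\<lambda>u. map (\<lambda>b. stack_cols
      ((replicate 4 Z)[b := prepend_mat u ([M\<^sub>1, M\<^sub>2, M\<^sub>3, M\<^sub>4] ! b)])) [0..<4]) rounds))"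
    unfolding Z N(1) by (intro transition_mat_Suc_Suc) auto
  then show ?thesis
    \<comment> \<open>Evaluating the lists and updates leaves the sixteen block rows as
      displayed.\<close>
    by (simp add: rounds_def upt_rec numeral_nat)
qed

end
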